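(* Let $H$ be a generalized Jacobi matrix associated with sequences $\{\varepsilon_jp_j\}_{j\ge 0}$, $\{b_j\}_{j\ge 0}$ such that there exists $N\in\mathbb{N}$ with $\deg p_j\le N$ for all $j\in\mathbb{Z}_+$ and $\sup\{b_j,|p^{(j)}_k|: j\in\mathbb{Z}_+,\ k=0,\dots,k_j-1\}<\infty$. Then for any $\lambda\in\rho(H)$ there exists a subsequence (depending on $\lambda$) of the diagonal Padé approximants to the function $m(\lambda)=[(H-\lambda)^{-1}e,e]$ which converges to $m(\lambda)$ at the point $\lambda$.
   Context: $\mathbb{Z}_+=\{0,1,2,\dots\}$; $\ell^2_{[0,\infty)}$ is the Hilbert space of complex square summable sequences $(w_0,w_1,\dots)$ with its usual inner product $(\cdot,\cdot)_{\ell^2}$. Data: for $j\in\mathbb{Z}_+$ let $p_j(\lambda)=\lambda^{k_j}+p^{(j)}_{k_j-1}\lambda^{k_j-1}+\dots+p^{(j)}_1\lambda+p^{(j)}_0$ be a real monic polynomial of degree $k_j\ge 1$, $\varepsilon_j\in\{1,-1\}$, $b_j>0$. Put $n_0=0$, $n_j=\sum_{i=0}^{j-1}k_i$ for $j\ge 1$. For a monic polynomial $p(\lambda)=\lambda^n+p_{n-1}\lambda^{n-1}+\dots+p_0$ (with $p_n=1$), the companion matrix $C_p$ is the $n\times n$ matrix with ones on the first subdiagonal, last column $(-p_0,-p_1,\dots,-p_{n-1})^\top$, and zeros elsewhere; $E_p$ is the $n\times n$ matrix with entries $(E_p)_{i,l}=p_{i+l+1}$, $0\le i,l\le n-1$,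 where $p_r=0$ for $r>n$. The generalized Jacobi matrix associated with $\{\varepsilon_jp_j\}$ and $\{b_j\}$ is the infinite tridiagonal block matrix $H$ with diagonal blocks $A_j=C_{p_j}$ ($k_j\times k_j$), subdiagonal blocks $B_j$ in block position $(j+1,j)$ ($k_{j+1}\times k_j$), and superdiagonal blocks $\widetilde B_j$ in block position $(j,j+1)$ ($k_j\times k_{j+1}$); the only nonzero entry of $B_j$ is its upper right corner entry, equal to $b_j$, and the only nonzero entry of $\widetilde B_j$ is its upper right corner entry, equal to $\varepsilon_j\varepsilon_{j+1}b_j$. Under the assumptions in the claim $H$ generates a bounded operator in $\ell^2_{[0,\infty)}$, with resolvent set $\rho(H)$. $G=\mathrm{diag}(G_0,G_1,\dots)$ with $G_j=\varepsilon_jE_{p_j}^{-1}$ (a bounded, boundedly invertible self-adjoint operator in $\ell^2_{[0,\infty)}$), $[x,y]=(Gx,y)_{\ell^2}$, and $e=(1,0,0,\dots)^\top$. The polynomials $P_j,Q_j$ are the solutions of $\varepsilon_{j-1}\varepsilon_jb_{j-1}u_{j-1}-p_j(\lambda)u_j+b_ju_{j+1}=0$ $(j\ge 1)$ with initial conditions $P_0=1$, $P_1=p_0(\lambda)/b_0$, $Q_0=0$, $Q_1=\varepsilon_0/b_0$. Padé approximants: the $[n/n]$ (the $n$-th diagonal) Padé approximant to $\varphi(\lambda)=-\sum_{j\ge0}s_j\lambda^{-j-1}$ is a ratio $f^{[n/n]}(\lambda)=A(1/\lambda)/B(1/\lambda)$ of polynomials $A,B$ of formal degree $n$ with $B(0)\neq0$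 and $\sum_{j\ge 0}s_j\lambda^{-j-1}+f^{[n/n]}(\lambda)=O(\lambda^{-(2n+1)})$ as $\lambda\to\infty$. For $m$, the $[n_j/n_j]$ Padé approximant exists for all $j\ge 1$ and equals $f^{[n_j/n_j]}(\lambda)=-Q_j(\lambda)/P_j(\lambda)$; the subsequence in the claim is a subsequence of these. *)

theory Defs
  imports
    Complex_Main
    "HOL-Library.Landau_Symbols"
    "HOL-Computational_Algebra.Polynomial"
    "Jordan_Normal_Form.Gauss_Jordan_Elimination"
begin

section \<open>The sequence space and resolvent sets\<close>

definition ell2 :: "(nat \<Rightarrow> complex) set" where
  "ell2 = {x. summable (\<lambda>i. (cmod (x i))\<^sup>2)}"

definition ell2_inner :: "(nat \<Rightarrow> complex) \<Rightarrow> (nat \<Rightarrow> complex) \<Rightarrow> complex" where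
  "ell2_inner x y = (\<Sum>i. x i * cnj (y i))"

definition ell2_norm :: "(nat \<Rightarrow> complex) \<Rightarrow> real" where
  "ell2_norm x = sqrt (\<Sum>i. (cmod (x i))\<^sup>2)"

definition shifted_op ::
  "((nat \<Rightarrow> complex) \<Rightarrow> nat \<Rightarrow> complex) \<Rightarrow> complex \<Rightarrow> (nat \<Rightarrow> complex) \<Rightarrow> nat \<Rightarrow> complex" where
  "shifted_op T z x = (\<lambda>i. T x i - z * x i)"

text \<open>For an operator acting in \<open>ell2\<close>: \<open>T - z\<close> is a bijection of \<open>ell2\<close>
  with bounded inverse.\<close>

definition resolvent_set :: "((nat \<Rightarrow> complex) \<Rightarrow> nat \<Rightarrow> complex) \<Rightarrow> complex set" where
  "resolvent_set T = {z. bij_betw (shifted_op T z) ell2 ell2 \<and>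
     (\<exists>C. \<forall>x\<in>ell2. ell2_norm x \<le> C * ell2_norm (shifted_op T z x))}"

text \<open>Meaningful only for \<open>z\<close> in the resolvent set.\<close>

definition resolvent ::
  "((nat \<Rightarrow> complex) \<Rightarrow> nat \<Rightarrow> complex) \<Rightarrow> complex \<Rightarrow> (nat \<Rightarrow> complex) \<Rightarrow> nat \<Rightarrow> complex" where
  "resolvent T z = inv_into ell2 (shifted_op T z)"

text \<open>All matrices below have finitely supported rows, so the series is a finite sum.\<close>

definition matrix_op :: "(nat \<Rightarrow> nat \<Rightarrow> real) \<Rightarrow> (nat \<Rightarrow> complex) \<Rightarrow> nat \<Rightarrow> complex" where
  "matrix_op M x = (\<lambda>i. \<Sum>l. complex_of_real (M i l) * x l)"

section \<open>Generalized Jacobi matrices\<close>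

definition companion_mat :: "real poly \<Rightarrow> real mat" where
  "companion_mat q = mat (degree q) (degree q)
     (\<lambda>(i, l). if l = degree q - 1 then - coeff q i else if i = l + 1 then 1 else 0)"

definition E_mat :: "real poly \<Rightarrow> real mat" where
  "E_mat q = mat (degree q) (degree q) (\<lambda>(i, l). coeff q (i + l + 1))"

definition offset :: "(nat \<Rightarrow> real poly) \<Rightarrow> nat \<Rightarrow> nat" where
  "offset p j = (\<Sum>i<j. degree (p i))"

text \<open>The block containing the scalar index \<open>i\<close>, i.e. the \<open>j\<close> with
  \<open>offset p j \<le> i < offset p (Suc j)\<close> (all degrees being positive).\<close>

definition block_of :: "(nat \<Rightarrow> real poly) \<Rightarrow> nat \<Rightarrow> nat" where
  "block_of p i = (LEAST j. i < offset p (Suc j))"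

definition assemble :: "(nat \<Rightarrow> real poly) \<Rightarrow> (nat \<Rightarrow> nat \<Rightarrow> real mat) \<Rightarrow> nat \<Rightarrow> nat \<Rightarrow> real" where
  "assemble p X i l = X (block_of p i) (block_of p l) $$
     (i - offset p (block_of p i), l - offset p (block_of p l))"

definition upper_right_mat :: "nat \<Rightarrow> nat \<Rightarrow> real \<Rightarrow> real mat" where
  "upper_right_mat r c a = mat r c (\<lambda>(i, l). if i = 0 \<and> l = c - 1 then a else 0)"

definition jacobi_block ::
  "(nat \<Rightarrow> real) \<Rightarrow> (nat \<Rightarrow> real poly) \<Rightarrow> (nat \<Rightarrow> real) \<Rightarrow> nat \<Rightarrow> nat \<Rightarrow> real mat" where
  "jacobi_block \<epsilon> p b j k =
     (if j = k then companion_mat (p j)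
      else if j = Suc k then upper_right_mat (degree (p j)) (degree (p k)) (b k)
      else if k = Suc j then upper_right_mat (degree (p j)) (degree (p k)) (\<epsilon> j * \<epsilon> k * b j)
      else 0\<^sub>m (degree (p j)) (degree (p k)))"

definition jacobi_op ::
  "(nat \<Rightarrow> real) \<Rightarrow> (nat \<Rightarrow> real poly) \<Rightarrow> (nat \<Rightarrow> real) \<Rightarrow> (nat \<Rightarrow> complex) \<Rightarrow> nat \<Rightarrow> complex" where
  "jacobi_op \<epsilon> p b = matrix_op (assemble p (jacobi_block \<epsilon> p b))"

text \<open>For monic \<open>q\<close> the matrix \<open>E_mat q\<close> vanishes below the antidiagonal, which consists
  of ones; hence it is invertible and \<open>mat_inverse\<close> does not return \<open>None\<close>.\<close>

definition gram_block ::
  "(nat \<Rightarrow> real) \<Rightarrow> (nat \<Rightarrow> real poly) \<Rightarrow> nat \<Rightarrow> nat \<Rightarrow> real mat" where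
  "gram_block \<epsilon> p j k =
     (if j = k then \<epsilon> j \<cdot>\<^sub>m the (mat_inverse (E_mat (p j)))
      else 0\<^sub>m (degree (p j)) (degree (p k)))"

definition indef_inner ::
  "(nat \<Rightarrow> real) \<Rightarrow> (nat \<Rightarrow> real poly) \<Rightarrow> (nat \<Rightarrow> complex) \<Rightarrow> (nat \<Rightarrow> complex) \<Rightarrow> complex" where
  "indef_inner \<epsilon> p x y = ell2_inner (matrix_op (assemble p (gram_block \<epsilon> p)) x) y"

definition e_vec :: "nat \<Rightarrow> complex" where
  "e_vec = (\<lambda>i. if i = 0 then 1 else 0)"

definition m_function ::
  "(nat \<Rightarrow> real) \<Rightarrow> (nat \<Rightarrow> real poly) \<Rightarrow> (nat \<Rightarrow> real) \<Rightarrow> complex \<Rightarrow> complex" where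
  "m_function \<epsilon> p b z = indef_inner \<epsilon> p (resolvent (jacobi_op \<epsilon> p b) z e_vec) e_vec"

section \<open>The polynomials of the first and second kind\<close>

fun recurrence_solution ::
  "(nat \<Rightarrow> real) \<Rightarrow> (nat \<Rightarrow> real poly) \<Rightarrow> (nat \<Rightarrow> real) \<Rightarrow> real poly \<Rightarrow> real poly \<Rightarrow> nat \<Rightarrow> real poly"
where
  "recurrence_solution \<epsilon> p b u0 u1 0 = u0"
| "recurrence_solution \<epsilon> p b u0 u1 (Suc 0) = u1"
| "recurrence_solution \<epsilon> p b u0 u1 (Suc (Suc j)) =
     Polynomial.smult (1 / b (Suc j))
       (p (Suc j) * recurrence_solution \<epsilon> p b u0 u1 (Suc j)
        - Polynomial.smult (\<epsilon> j * \<epsilon> (Suc j) * b j) (recurrence_solution \<epsilon> p b u0 u1 j))"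

definition P_poly :: "(nat \<Rightarrow> real) \<Rightarrow> (nat \<Rightarrow> real poly) \<Rightarrow> (nat \<Rightarrow> real) \<Rightarrow> nat \<Rightarrow> complex poly" where
  "P_poly \<epsilon> p b j =
     map_poly complex_of_real (recurrence_solution \<epsilon> p b 1 (Polynomial.smult (1 / b 0) (p 0)) j)"

definition Q_poly :: "(nat \<Rightarrow> real) \<Rightarrow> (nat \<Rightarrow> real poly) \<Rightarrow> (nat \<Rightarrow> real) \<Rightarrow> nat \<Rightarrow> complex poly" where
  "Q_poly \<epsilon> p b j =
     map_poly complex_of_real (recurrence_solution \<epsilon> p b 0 [:\<epsilon> 0 / b 0:] j)"

lemma recurrence_solution_eq:
  fixes u0 u1 :: "real poly" and \<epsilon> b :: "nat \<Rightarrow> real" and p :: "nat \<Rightarrow> real poly"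
  defines "u \<equiv> recurrence_solution \<epsilon> p b u0 u1"
  assumes "j \<ge> 1" and "b j > 0"
  shows "Polynomial.smult (\<epsilon> (j - 1) * \<epsilon> j * b (j - 1)) (u (j - 1)) - p j * u j + Polynomial.smult (b j) (u (j + 1)) = 0"
proof -
  obtain i where j: "j = Suc i" using assms(2) by (cases j) auto
  show ?thesis using assms(3) unfolding u_def j by simp
qed

section \<open>Diagonal Pade approximants\<close>

text \<open>The rational function \<open>R/D\<close> (quotient of polynomials in \<open>z\<close>) is an \<open>[n/n]\<close> Pade
  approximant to \<open>\<phi>\<close>, where \<open>\<phi>(z) = - (\<Sum>j. s j / z^(j+1))\<close> near infinity. The form
  \<open>A(1/z)/B(1/z)\<close> does not make sense at \<open>z = 0\<close>; equality of it with \<open>R/D\<close> is therefore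
  required at all points where both quotients are genuine, i.e. at all but finitely many.\<close>

definition is_diagonal_pade ::
  "(complex \<Rightarrow> complex) \<Rightarrow> nat \<Rightarrow> complex poly \<Rightarrow> complex poly \<Rightarrow> bool" where
  "is_diagonal_pade \<phi> n R D \<longleftrightarrow> D \<noteq> 0 \<and>
     (\<exists>s A B.
        (\<forall>\<^sub>F z in at_infinity. (\<lambda>j. - (s j / z ^ (j + 1))) sums \<phi> z) \<and>
        degree A \<le> n \<and> degree B \<le> n \<and> poly B 0 \<noteq> 0 \<and>
        (\<forall>z. z \<noteq> 0 \<longrightarrow> poly D z \<noteq> 0 \<longrightarrow> poly B (1 / z) \<noteq> 0 \<longrightarrow>
           poly R z / poly D z = poly A (1 / z) / poly B (1 / z)) \<and>
        (\<lambda>z. (\<Sum>j. s j / z ^ (j + 1)) + poly A (1 / z) / poly B (1 / z))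
          \<in> O[at_infinity](\<lambda>z. 1 / z ^ (2 * n + 1)))"

end

theory Submission
  imports Defs "Jordan_Normal_Form.Determinant"
begin

text \<open>Let \<open>x = (H - z)\<^sup>-\<^sup>1 e\<close>. Eliminating the other entries of each block shows that the last
  entry of block \<open>j\<close> is \<open>\<epsilon>\<^sub>j w\<^sub>j\<close> with \<open>w\<^sub>j = Q\<^sub>j(z) + m(z) P\<^sub>j(z)\<close>; hence \<open>w\<^sub>j \<rightarrow> 0\<close>. The Wronskian
  \<open>P\<^sub>j w\<^sub>j\<^sub>+\<^sub>1 - P\<^sub>j\<^sub>+\<^sub>1 w\<^sub>j = \<epsilon>\<^sub>j / b\<^sub>j\<close> is bounded away from \<open>0\<close>, so \<open>\<bar>P\<^sub>j(z)\<bar> \<ge> 1\<close> infinitely often, and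
  along these \<open>j\<close> the error \<open>- Q\<^sub>j / P\<^sub>j - m = - w\<^sub>j / P\<^sub>j\<close> tends to \<open>0\<close>. That \<open>- Q\<^sub>j / P\<^sub>j\<close> is a
  Pade approximant is read off from the Neumann series of \<open>x\<close> for large \<open>z\<close>, since \<open>H\<^sup>k e\<close> is
  supported on \<open>{0..k}\<close>; the sup norm suffices to control this series.\<close>

section \<open>The block equations\<close>

lemma map_poly_of_real_mult:
  "map_poly complex_of_real (q * r) = map_poly complex_of_real q * map_poly complex_of_real r"
  by (rule poly_eqI) (simp add: coeff_map_poly coeff_mult)

lemma map_poly_of_real_diff:
  "map_poly complex_of_real (q - r) = map_poly complex_of_real q - map_poly complex_of_real r"
  by (rule poly_eqI) (simp add: coeff_map_poly)

lemma map_poly_of_real_smult: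
  "map_poly complex_of_real (Polynomial.smult c q) =
     Polynomial.smult (complex_of_real c) (map_poly complex_of_real q)"
  by (rule poly_eqI) (simp add: coeff_map_poly)

lemma degree_map_poly_of_real: "degree (map_poly complex_of_real q) = degree q"
  by (simp add: degree_map_poly)

lemma poly_map_monic:
  assumes "lead_coeff q = 1"
  shows "poly (map_poly complex_of_real q) z =
     (\<Sum>r<degree q. complex_of_real (coeff q r) * z ^ r) + z ^ degree q"
proof -
  have "{..degree q} = insert (degree q) {..<degree q}" by auto
  then show ?thesis
    using assms by (simp add: poly_altdef degree_map_poly_of_real coeff_map_poly add.commute)
qed

locale jacobi_data =
  fixes p :: "nat \<Rightarrow> real poly" and \<epsilon> b :: "nat \<Rightarrow> real"
  assumes monic: "lead_coeff (p j) = 1"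
    and degree_pos: "1 \<le> degree (p j)"
    and signs: "\<epsilon> j \<in> {1, -1}"
    and b_pos: "0 < b j"
    and coeff_bound:
      "bdd_above ({b j | j. True} \<union> {\<bar>coeff (p j) k\<bar> | j k. k < degree (p j)})"
begin

lemma sign_square: "complex_of_real (\<epsilon> j) * complex_of_real (\<epsilon> j) = 1"
  using signs[of j] by auto

lemma abs_sign: "\<bar>\<epsilon> j\<bar> = 1"
  using signs[of j] by auto

section \<open>Scalar indices and the blocks containing them\<close>

lemma offset_0: "offset p 0 = 0"
  by (simp add: offset_def)

lemma offset_Suc: "offset p (Suc j) = offset p j + degree (p j)"
  by (simp add: offset_def)

lemma offset_mono: "i \<le> j \<Longrightarrow> offset p i \<le> offset p j"
  by (rule lift_Suc_mono_le) (simp_all add: offset_Suc)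

lemma offset_less_Suc: "offset p j < offset p (Suc j)"
  using degree_pos[of j] by (simp add: offset_Suc)

lemma offset_ge: "j \<le> offset p j"
proof (induction j)
  case (Suc j)
  then show ?case using offset_less_Suc[of j] by linarith
qed simp

lemma block_of_offset:
  assumes "r < degree (p j)"
  shows "block_of p (offset p j + r) = j"
  unfolding block_of_def
proof (rule Least_equality)
  show "offset p j + r < offset p (Suc j)"
    using assms by (simp add: offset_Suc)
next
  fix k assume *: "offset p j + r < offset p (Suc k)"
  show "j \<le> k"
  proof (rule ccontr)
    assume "\<not> j \<le> k"
    then have "offset p (Suc k) \<le> offset p j" by (intro offset_mono) simp
    with * show False by simp
  qed
qed

text \<open>Statements about a scalar index are proved by splitting it into a block and a position
  in that block; the block is the one chosen by \<open>block_of\<close>, and it exists because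
  \<open>offset p j\<close> is at least \<open>j\<close>.\<close>

lemma index_cases:
  obtains j r where "i = offset p j + r" "r < degree (p j)"
proof -
  define j where "j = (LEAST j. i < offset p (Suc j))"
  have lt: "i < offset p (Suc j)"
    unfolding j_def by (rule LeastI[of _ i]) (use offset_ge[of "Suc i"] in linarith)
  have ge: "offset p j \<le> i"
  proof (cases j)
    case (Suc k)
    have "\<not> i < offset p (Suc k)"
      using not_less_Least[of k "\<lambda>j. i < offset p (Suc j)"] Suc unfolding j_def by simp
    then show ?thesis using Suc by simp
  qed (simp add: offset_0)
  show thesis
    using that[of j "i - offset p j"] lt ge by (simp add: offset_Suc)
qed

abbreviation last_index :: "nat \<Rightarrow> nat" where
  "last_index j \<equiv> offset p (Suc j) - 1"

lemma last_index_eq: "last_index j = offset p j + (degree (p j) - 1)"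
  using degree_pos[of j] by (simp add: offset_Suc)

lemma last_index_iff:
  assumes "c < degree (p k)"
  shows "offset p k + c = last_index j \<longleftrightarrow> k = j \<and> c = degree (p j) - 1"
proof
  assume *: "offset p k + c = last_index j"
  have "block_of p (offset p k + c) = k"
    by (rule block_of_offset) fact
  moreover have "block_of p (last_index j) = j"
    unfolding last_index_eq by (rule block_of_offset) (use degree_pos[of j] in simp)
  ultimately show "k = j \<and> c = degree (p j) - 1"
    using * last_index_eq[of j] by auto
next
  assume "k = j \<and> c = degree (p j) - 1"
  then show "offset p k + c = last_index j" using last_index_eq[of j] by simp
qed

text \<open>The corner entry of block \<open>(Suc k, k)\<close> lies in the first row of block
  \<open>Suc k\<close> and the last column of block \<open>k\<close>, so its scalar position is
  directly below the diagonal. Together with the ones of the companion blocks these corners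
  therefore fill exactly one scalar subdiagonal.\<close>

lemma predecessor_iff:
  assumes r: "r < degree (p j)" and c: "c < degree (p k)"
  shows "Suc (offset p k + c) = offset p j + r \<longleftrightarrow>
     (k = j \<and> Suc c = r) \<or> (j = Suc k \<and> r = 0 \<and> c = degree (p k) - 1)"
proof (cases "Suc c < degree (p k)")
  case True
  have "Suc (offset p k + c) = offset p j + r \<longleftrightarrow> k = j \<and> Suc c = r"
    using block_of_offset[OF True] block_of_offset[OF r] by auto
  then show ?thesis using True by auto
next
  case False
  then have c': "c = degree (p k) - 1" using c by simp
  have "Suc (offset p k + c) = offset p (Suc k) + 0"
    using c' degree_pos[of k] by (simp add: offset_Suc)
  moreover have "offset p (Suc k) + 0 = offset p j + r \<longleftrightarrow> j = Suc k \<and> r = 0"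
  proof
    assume *: "offset p (Suc k) + 0 = offset p j + r"
    have "block_of p (offset p (Suc k) + 0) = Suc k"
      by (rule block_of_offset) (use degree_pos[of "Suc k"] in simp)
    then have "j = Suc k"
      unfolding * block_of_offset[OF r] .
    with * show "j = Suc k \<and> r = 0" by simp
  qed simp
  ultimately have "Suc (offset p k + c) = offset p j + r \<longleftrightarrow> j = Suc k \<and> r = 0"
    by (simp only:)
  moreover have "\<not> (k = j \<and> Suc c = r)"
    using False r by auto
  ultimately show ?thesis using c' by blast
qed

text \<open>A row meets the subdiagonal, the last column of its own companion block and, for
  \<open>r = 0\<close>, the corner of the block to the right. For \<open>j = 0\<close> and
  \<open>r = 0\<close> the truncated \<open>b (j - 1)\<close> is never selected, since
  \<open>Suc l\<close> is not \<open>0\<close>.\<close>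

lemma jacobi_entry:
  assumes r: "r < degree (p j)"
  shows "assemble p (jacobi_block \<epsilon> p b) (offset p j + r) l =
     (if Suc l = offset p j + r then (if r = 0 then b (j - 1) else 1) else 0)
     + (if l = last_index j then - coeff (p j) r else 0)
     + (if l = last_index (Suc j) then (if r = 0 then \<epsilon> j * \<epsilon> (Suc j) * b j else 0) else 0)"
proof -
  obtain k c where l: "l = offset p k + c" and c: "c < degree (p k)"
    by (rule index_cases)
  have "assemble p (jacobi_block \<epsilon> p b) (offset p j + r) l = jacobi_block \<epsilon> p b j k $$ (r, c)"
    unfolding l assemble_def block_of_offset[OF r] block_of_offset[OF c] by simp
  then show ?thesis
    unfolding l last_index_iff[OF c] predecessor_iff[OF r c]
    using r c by (auto simp: jacobi_block_def companion_mat_def upper_right_mat_def)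
qed

text \<open>Each row has at most three nonzero entries, so the series in \<open>matrix_op\<close>
  collapses for an arbitrary sequence \<open>x\<close>, square summable or not. This permits the
  later work with entrywise limits and sup norms.\<close>

lemma jacobi_op_eq:
  assumes r: "r < degree (p j)"
  shows "jacobi_op \<epsilon> p b x (offset p j + r) =
     (if r = 0 then if j = 0 then 0 else complex_of_real (b (j - 1)) * x (last_index (j - 1))
      else x (offset p j + (r - 1)))
     - complex_of_real (coeff (p j) r) * x (last_index j)
     + (if r = 0 then complex_of_real (\<epsilon> j * \<epsilon> (Suc j) * b j) * x (last_index (Suc j)) else 0)"
proof -
  let ?s = "if r = 0 then if j = 0 then 0 else complex_of_real (b (j - 1)) * x (last_index (j - 1))
      else x (offset p j + (r - 1))"
  have 1: "(\<lambda>l. if Suc l = offset p j + r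
              then complex_of_real (if r = 0 then b (j - 1) else 1) * x l else 0) sums ?s"
  proof (cases "offset p j + r")
    case 0
    then have "j = 0" "r = 0" using offset_ge[of j] by auto
    then show ?thesis by (simp add: offset_0)
  next
    case (Suc i)
    have "(\<lambda>l. if l = i
              then complex_of_real (if r = 0 then b (j - 1) else 1) * x l else 0)
          sums (complex_of_real (if r = 0 then b (j - 1) else 1) * x i)"
      by (rule sums_single)
    moreover have "complex_of_real (if r = 0 then b (j - 1) else 1) * x i = ?s"
      using Suc by (cases j) (auto simp: offset_0)
    ultimately show ?thesis unfolding Suc by simp
  qed
  have 2: "(\<lambda>l. if l = last_index j then complex_of_real (- coeff (p j) r) * x l else 0)
      sums (complex_of_real (- coeff (p j) r) * x (last_index j))"
    by (rule sums_single)
  have 3: "(\<lambda>l. if l = last_index (Suc j)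
         then complex_of_real (if r = 0 then \<epsilon> j * \<epsilon> (Suc j) * b j else 0) * x l else 0)
      sums (complex_of_real (if r = 0 then \<epsilon> j * \<epsilon> (Suc j) * b j else 0) * x (last_index (Suc j)))"
    by (rule sums_single)
  have eq: "complex_of_real (assemble p (jacobi_block \<epsilon> p b) (offset p j + r) l) * x l =
     (if Suc l = offset p j + r
              then complex_of_real (if r = 0 then b (j - 1) else 1) * x l else 0)
     + (if l = last_index j then complex_of_real (- coeff (p j) r) * x l else 0)
     + (if l = last_index (Suc j)
         then complex_of_real (if r = 0 then \<epsilon> j * \<epsilon> (Suc j) * b j else 0) * x l else 0)" for l
    unfolding jacobi_entry[OF r] of_real_add distrib_right
    by (intro arg_cong2[of _ _ _ _ "(+)"]) simp_all
  have "(\<lambda>l. complex_of_real (assemble p (jacobi_block \<epsilon> p b) (offset p j + r) l) * x l) sums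
     (?s + complex_of_real (- coeff (p j) r) * x (last_index j)
      + complex_of_real (if r = 0 then \<epsilon> j * \<epsilon> (Suc j) * b j else 0) * x (last_index (Suc j)))"
    unfolding eq by (intro sums_add 1 2 3)
  then show ?thesis
    unfolding jacobi_op_def matrix_op_def sums_iff by simp
qed

text \<open>Weighting row \<open>r\<close> of a block by \<open>z ^ r\<close> and summing makes all entries of the block
  telescope except the last one, which turns the block equation into the three-term
  recurrence.\<close>

lemma block_equation:
  "(\<Sum>r<degree (p j). z ^ r * shifted_op (jacobi_op \<epsilon> p b) z x (offset p j + r)) =
     (if j = 0 then 0 else complex_of_real (b (j - 1)) * x (last_index (j - 1)))
     - poly (map_poly complex_of_real (p j)) z * x (last_index j)
     + complex_of_real (\<epsilon> j * \<epsilon> (Suc j) * b j) * x (last_index (Suc j))"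
proof -
  define d where "d = degree (p j) - 1"
  have d: "degree (p j) = Suc d" using degree_pos[of j] by (simp add: d_def)
  \<comment> \<open>Both neighbouring blocks act only on the first row of block \<open>j\<close>;
    \<open>c\<close> is their joint contribution.\<close>
  define c where "c = (if j = 0 then 0 else complex_of_real (b (j - 1)) * x (last_index (j - 1)))
     + complex_of_real (\<epsilon> j * \<epsilon> (Suc j) * b j) * x (last_index (Suc j))"
  define y where "y = x (last_index j)"
  let ?v = "\<lambda>r. x (offset p j + r)"
  have y: "y = ?v d" unfolding y_def last_index_eq d_def ..
  have row: "shifted_op (jacobi_op \<epsilon> p b) z x (offset p j + r) =
     (if r = 0 then c else ?v (r - 1)) - complex_of_real (coeff (p j) r) * y - z * ?v r"
    if "r < Suc d" for r
    using that unfolding shifted_op_def c_def y_def by (subst jacobi_op_eq) (auto simp: d)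
  have "(\<Sum>r<Suc d. z ^ r * shifted_op (jacobi_op \<epsilon> p b) z x (offset p j + r)) =
     (\<Sum>r<Suc d. z ^ r * (if r = 0 then c else ?v (r - 1)) - z ^ Suc r * ?v r
        - complex_of_real (coeff (p j) r) * z ^ r * y)"
    by (intro sum.cong refl, subst row) (simp_all only: lessThan_iff right_diff_distrib power_Suc, simp_all add: mult_ac)
  also have "\<dots> = (\<Sum>r<Suc d. z ^ r * (if r = 0 then c else ?v (r - 1)) - z ^ Suc r * ?v r)
      - (\<Sum>r<Suc d. complex_of_real (coeff (p j) r) * z ^ r) * y"
    by (simp only: sum_subtractf sum_distrib_right)
  also have "(\<Sum>r<Suc d. z ^ r * (if r = 0 then c else ?v (r - 1)) - z ^ Suc r * ?v r) =
      c - z ^ Suc d * ?v d"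
    by (induction d) simp_all
  finally show ?thesis
    unfolding poly_map_monic[OF monic] d y_def[symmetric] by (simp add: y c_def algebra_simps)
qed

end

section \<open>The Weyl solution\<close>

text \<open>The kernel is trivial by induction on the entries of \<open>v\<close>: in row
  \<open>n - 1 - l\<close> the entries right of column \<open>l\<close> are coefficients beyond the
  degree, the one in column \<open>l\<close> is the leading \<open>1\<close>, and the earlier
  entries of \<open>v\<close> vanish already.\<close>

lemma E_mat_invertible:
  assumes "lead_coeff q = 1" "1 \<le> degree q"
  obtains B where "mat_inverse (E_mat q) = Some B"
proof -
  define n where "n = degree q"
  have top: "coeff q n = 1" using assms(1) by (simp add: n_def)
  have E: "E_mat q \<in> carrier_mat n n" by (simp add: E_mat_def n_def)
  have "v = 0\<^sub>v n" if v: "v \<in> carrier_vec n" and Ev: "E_mat q *\<^sub>v v = 0\<^sub>v n" for v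
  proof -
    have "l < n \<longrightarrow> v $ l = 0" for l
    proof (induction l rule: less_induct)
      case (less l)
      show ?case
      proof
        assume l: "l < n"
        define i where "i = n - 1 - l"
        have i: "i < n" using l by (simp add: i_def)
        have "0 = (E_mat q *\<^sub>v v) $ i" using Ev i by simp
        also have "\<dots> = (\<Sum>k\<in>{0..<n}. coeff q (i + k + 1) * v $ k)"
          using i v by (simp add: E_mat_def n_def scalar_prod_def)
        also have "\<dots> = (\<Sum>k\<in>{l}. coeff q (i + k + 1) * v $ k)"
        proof (rule sum.mono_neutral_right)
          show "\<forall>k\<in>{0..<n} - {l}. coeff q (i + k + 1) * v $ k = 0"
          proof
            fix k assume k: "k \<in> {0..<n} - {l}"
            show "coeff q (i + k + 1) * v $ k = 0"
            proof (cases "k < l")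
              case True
              then show ?thesis using less.IH[of k] l by simp
            next
              case False
              then have "l < k" using k by auto
              then have "n < i + k + 1" using l unfolding i_def by linarith
              then show ?thesis by (simp add: n_def coeff_eq_0)
            qed
          qed
        qed (use l in auto)
        also have "\<dots> = v $ l" using l top by (simp add: i_def)
        finally show "v $ l = 0" by simp
      qed
    qed
    then show ?thesis using v by (intro eq_vecI) auto
  qed
  then have "det (E_mat q) \<noteq> 0"
    using det_0_iff_vec_prod_zero_field[OF E] by blast
  then have "E_mat q \<in> Units (ring_mat TYPE(real) n ())"
    by (rule det_non_zero_imp_unit[OF E])
  then show thesis
    using mat_inverse(1)[OF E, of "()"] that by (cases "mat_inverse (E_mat q)") auto
qed

text \<open>The last row of \<open>E_mat q\<close> is \<open>(1, 0, ..., 0)\<close>, so the last row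
  of the product \<open>E_mat q * B = 1\<close> is the first row of \<open>B\<close>. This makes the
  indefinite pairing with \<open>e_vec\<close> explicit.\<close>

lemma E_mat_inverse_first_row:
  assumes "lead_coeff q = 1" "1 \<le> degree q" and c: "c < degree q"
  shows "the (mat_inverse (E_mat q)) \<in> carrier_mat (degree q) (degree q)"
    and "the (mat_inverse (E_mat q)) $$ (0, c) = (if c = degree q - 1 then 1 else 0)"
proof -
  define n where "n = degree q"
  have n: "n - 1 < n" "c < n" using assms(2) c by (simp_all add: n_def)
  have E: "E_mat q \<in> carrier_mat n n" by (simp add: E_mat_def n_def)
  obtain B where B: "mat_inverse (E_mat q) = Some B"
    using E_mat_invertible assms(1,2) by blast
  from mat_inverse(2)[OF E B] have EB: "E_mat q * B = 1\<^sub>m n" and Bc: "B \<in> carrier_mat n n"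
    by auto
  show "the (mat_inverse (E_mat q)) \<in> carrier_mat (degree q) (degree q)"
    using B Bc by (simp add: n_def)
  have "(E_mat q * B) $$ (n - 1, c) = (\<Sum>l\<in>{0..<n}. coeff q (n - 1 + l + 1) * B $$ (l, c))"
    using n Bc by (simp add: E_mat_def n_def scalar_prod_def)
  also have "\<dots> = (\<Sum>l\<in>{0}. coeff q (n - 1 + l + 1) * B $$ (l, c))"
    by (rule sum.mono_neutral_right) (use n in \<open>auto simp: n_def coeff_eq_0\<close>)
  also have "\<dots> = B $$ (0, c)"
    using n assms(1) by (simp add: n_def)
  finally show "the (mat_inverse (E_mat q)) $$ (0, c) = (if c = degree q - 1 then 1 else 0)"
    unfolding EB using B n by (auto simp: n_def)
qed

section \<open>Square summable sequences and the resolvent\<close>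

lemma ell2_tendsto_0:
  assumes "x \<in> ell2"
  shows "x \<longlonglongrightarrow> 0"
proof -
  have "(\<lambda>i. (cmod (x i))\<^sup>2) \<longlonglongrightarrow> 0"
    using assms unfolding ell2_def by (intro summable_LIMSEQ_zero) simp
  then have "(\<lambda>i. sqrt ((cmod (x i))\<^sup>2)) \<longlonglongrightarrow> sqrt 0"
    by (intro tendsto_intros)
  then show ?thesis by (simp add: tendsto_norm_zero_iff)
qed

lemma e_vec_in_ell2: "e_vec \<in> ell2"
proof -
  have "(\<lambda>i. (cmod (e_vec i))\<^sup>2) = (\<lambda>i. if i = 0 then 1 else 0)"
    by (simp add: e_vec_def fun_eq_iff)
  then show ?thesis by (simp add: ell2_def)
qed

lemma resolvent_solves:
  assumes "z \<in> resolvent_set T" and "y \<in> ell2"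
  shows "resolvent T z y \<in> ell2" and "shifted_op T z (resolvent T z y) = y"
proof -
  have "shifted_op T z ` ell2 = ell2"
    using assms(1) unfolding resolvent_set_def bij_betw_def by simp
  then have y: "y \<in> shifted_op T z ` ell2" using assms(2) by simp
  show "resolvent T z y \<in> ell2" "shifted_op T z (resolvent T z y) = y"
    unfolding resolvent_def using inv_into_into[OF y] f_inv_into_f[OF y] by auto
qed

text \<open>As \<open>resolvent\<close> is defined by choice of a preimage, a unique square summable
  solution determines its value at \<open>y\<close> even where membership of \<open>z\<close> in the
  resolvent set has not been established. For large \<open>z\<close> it is used in this way.\<close>

lemma resolvent_eqI:
  assumes "x \<in> ell2" and "shifted_op T z x = y"
    and "\<And>x'. x' \<in> ell2 \<Longrightarrow> shifted_op T z x' = y \<Longrightarrow> x' = x"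
  shows "resolvent T z y = x"
  unfolding resolvent_def inv_into_def using assms by (intro some_equality conjI) blast+

context jacobi_data
begin

lemma matrix_op_gram_0:
  "matrix_op (assemble p (gram_block \<epsilon> p)) x 0 = complex_of_real (\<epsilon> 0) * x (last_index 0)"
proof -
  have b0: "block_of p 0 = 0"
    using block_of_offset[of 0 0] degree_pos[of 0] by (simp add: offset_0)
  have "assemble p (gram_block \<epsilon> p) 0 l = (if l = last_index 0 then \<epsilon> 0 else 0)" for l
  proof -
    obtain k c where l: "l = offset p k + c" and c: "c < degree (p k)"
      by (rule index_cases)
    have "assemble p (gram_block \<epsilon> p) 0 l = gram_block \<epsilon> p 0 k $$ (0, c)"
      unfolding l assemble_def block_of_offset[OF c] b0 by (simp add: offset_0)
    also have "\<dots> = (if k = 0 \<and> c = degree (p 0) - 1 then \<epsilon> 0 else 0)"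
      using E_mat_inverse_first_row[OF monic degree_pos, of c 0] c degree_pos[of 0]
      by (auto simp: gram_block_def)
    finally show ?thesis unfolding l last_index_iff[OF c] .
  qed
  then have "matrix_op (assemble p (gram_block \<epsilon> p)) x 0 =
     (\<Sum>l. if l = last_index 0 then complex_of_real (\<epsilon> 0) * x l else 0)"
    unfolding matrix_op_def by (intro suminf_cong) simp
  also have "\<dots> = complex_of_real (\<epsilon> 0) * x (last_index 0)"
    by (rule sums_unique[symmetric]) (rule sums_single)
  finally show ?thesis .
qed

text \<open>Reduces \<open>m_function\<close> to one coordinate of the resolvent vector, the last
  one of block \<open>0\<close>.\<close>

lemma indef_inner_e_vec:
  "indef_inner \<epsilon> p x e_vec = complex_of_real (\<epsilon> 0) * x (last_index 0)"
proof -
  have "indef_inner \<epsilon> p x e_vec =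
      (\<Sum>i. if i = 0 then matrix_op (assemble p (gram_block \<epsilon> p)) x i else 0)"
    unfolding indef_inner_def ell2_inner_def e_vec_def by (intro suminf_cong) simp
  also have "\<dots> = matrix_op (assemble p (gram_block \<epsilon> p)) x 0"
    by (rule sums_unique[symmetric]) (rule sums_single)
  finally show ?thesis by (simp add: matrix_op_gram_0)
qed

section \<open>The three-term recurrence and the Wronskian\<close>

abbreviation P :: "nat \<Rightarrow> complex poly" where "P \<equiv> P_poly \<epsilon> p b"
abbreviation Q :: "nat \<Rightarrow> complex poly" where "Q \<equiv> Q_poly \<epsilon> p b"
abbreviation pc :: "nat \<Rightarrow> complex poly" where "pc j \<equiv> map_poly complex_of_real (p j)"

lemma poly_initial:
  "poly (P 0) z = 1" "complex_of_real (b 0) * poly (P 1) z = poly (pc 0) z"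
  "poly (Q 0) z = 0" "complex_of_real (b 0) * poly (Q 1) z = complex_of_real (\<epsilon> 0)"
  using b_pos[of 0]
  by (simp_all add: P_poly_def Q_poly_def map_poly_of_real_smult map_poly_pCons)

lemma poly_recurrence:
  fixes j z
  defines "c \<equiv> complex_of_real (\<epsilon> j) * complex_of_real (\<epsilon> (Suc j)) * complex_of_real (b j)"
  shows "complex_of_real (b (Suc j)) * poly (P (Suc (Suc j))) z =
      poly (pc (Suc j)) z * poly (P (Suc j)) z - c * poly (P j) z"
    and "complex_of_real (b (Suc j)) * poly (Q (Suc (Suc j))) z =
      poly (pc (Suc j)) z * poly (Q (Suc j)) z - c * poly (Q j) z"
  using b_pos[of "Suc j"] unfolding c_def
  by (simp_all add: P_poly_def Q_poly_def map_poly_of_real_smult map_poly_of_real_diff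
      map_poly_of_real_mult)

text \<open>By \<open>block_equation\<close>, the last entries multiplied by their signs satisfy the
  recurrence of \<open>P\<close> and \<open>Q\<close>. The right-hand side \<open>e_vec\<close>
  contributes a \<open>1\<close> to the equation of block \<open>0\<close> alone, and this
  inhomogeneity is what the initial value \<open>Q 1\<close> absorbs.\<close>

lemma last_entry_eq:
  assumes x: "shifted_op (jacobi_op \<epsilon> p b) z x = e_vec"
  defines "m \<equiv> complex_of_real (\<epsilon> 0) * x (last_index 0)"
  shows "x (last_index j) = complex_of_real (\<epsilon> j) * (poly (Q j) z + m * poly (P j) z)"
proof -
  define y where "y j = x (last_index j)" for j
  define u where "u j = poly (Q j) z + m * poly (P j) z" for j
  let ?e = "\<lambda>j. complex_of_real (\<epsilon> j)" and ?b = "\<lambda>j. complex_of_real (b j)"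
  have rhs: "(\<Sum>r<degree (p j). z ^ r * e_vec (offset p j + r)) = (if j = 0 then 1 else 0)" for j
  proof (cases j)
    case 0
    have "(\<Sum>r<degree (p 0). z ^ r * e_vec (offset p 0 + r)) =
        (\<Sum>r<degree (p 0). if r = 0 then 1 else 0)"
      by (intro sum.cong) (auto simp: e_vec_def offset_0)
    then show ?thesis using degree_pos[of 0] 0 by simp
  next
    case (Suc i)
    then show ?thesis using offset_ge[of j] by (simp add: e_vec_def)
  qed
  have eq0: "- poly (pc 0) z * y 0 + ?e 0 * ?e 1 * ?b 0 * y 1 = 1"
    using block_equation[of z x 0] unfolding x rhs y_def by simp
  have eqS: "?b j * y j - poly (pc (Suc j)) z * y (Suc j)
      + ?e (Suc j) * ?e (Suc (Suc j)) * ?b (Suc j) * y (Suc (Suc j)) = 0" for j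
    using block_equation[of z x "Suc j"] unfolding x rhs y_def by simp
  \<comment> \<open>Two consecutive indices are carried along because the recurrence has order
    two.\<close>
  have "y j = ?e j * u j \<and> y (Suc j) = ?e (Suc j) * u (Suc j)"
  proof (induction j)
    case 0
    have u0: "u 0 = m" by (simp add: u_def poly_initial)
    have u1: "?b 0 * u 1 = ?e 0 + m * poly (pc 0) z"
      unfolding u_def distrib_left mult.left_commute[of "?b 0" m] by (simp only: poly_initial)
    have m: "m = ?e 0 * y 0" by (simp add: m_def y_def)
    \<comment> \<open>Squares of signs equal \<open>1\<close>; inserting them produces the
      coefficient of \<open>y 1\<close> in \<open>eq0\<close>.\<close>
    have "?b 0 * y 1 = (?e 0 * ?e 0) * (?e 1 * ?e 1) * (?b 0 * y 1)"
      by (simp only: sign_square mult_1_left)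
    also have "\<dots> = ?e 0 * ?e 1 * (?e 0 * ?e 1 * ?b 0 * y 1)"
      by (simp only: mult_ac)
    also have "?e 0 * ?e 1 * ?b 0 * y 1 = 1 + poly (pc 0) z * y 0"
      using eq0 by (simp add: algebra_simps)
    also have "?e 0 * ?e 1 * (1 + poly (pc 0) z * y 0) = ?e 1 * (?b 0 * u 1)"
      unfolding u1 m by (simp add: algebra_simps)
    finally have "?b 0 * y 1 = ?b 0 * (?e 1 * u 1)"
      by (simp only: mult_ac)
    then show ?case
      using b_pos[of 0] sign_square[of 0] by (simp add: u0 m mult.assoc[symmetric])
  next
    case (Suc j)
    let ?e1 = "?e (Suc j)" and ?e2 = "?e (Suc (Suc j))" and ?p = "poly (pc (Suc j)) z"
    have u: "?b (Suc j) * u (Suc (Suc j)) = ?p * u (Suc j) - ?e j * ?e1 * ?b j * u j"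
      unfolding u_def distrib_left mult.left_commute[of "?b (Suc j)" m] poly_recurrence
      by (simp add: algebra_simps)
    have "?b (Suc j) * y (Suc (Suc j)) = (?e1 * ?e1) * (?e2 * ?e2) * (?b (Suc j) * y (Suc (Suc j)))"
      by (simp only: sign_square mult_1_left)
    also have "\<dots> = ?e1 * ?e2 * (?e1 * ?e2 * ?b (Suc j) * y (Suc (Suc j)))"
      by (simp only: mult_ac)
    also have "?e1 * ?e2 * ?b (Suc j) * y (Suc (Suc j)) = ?p * y (Suc j) - ?b j * y j"
      using eqS[of j] by (metis add_eq_0_iff minus_diff_eq)
    also have "?e1 * ?e2 * \<dots> = ?e2 * ((?e1 * ?e1) * (?p * u (Suc j)) - ?e j * ?e1 * ?b j * u j)"
      using Suc by (simp add: algebra_simps)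
    also have "\<dots> = ?b (Suc j) * (?e2 * u (Suc (Suc j)))"
      unfolding sign_square mult_1_left u[symmetric] by (rule mult.left_commute)
    finally have "?b (Suc j) * y (Suc (Suc j)) = ?b (Suc j) * (?e2 * u (Suc (Suc j)))" .
    with Suc b_pos[of "Suc j"] show ?case by simp
  qed
  then show ?thesis by (simp add: y_def u_def)
qed

text \<open>In the step the terms with \<open>pc (Suc j)\<close> cancel, so the weighted Wronskian
  is multiplied by the product of the signs of \<open>j\<close> and \<open>Suc j\<close>; the sign
  of \<open>j\<close> then squares to \<open>1\<close>.\<close>

lemma wronskian:
  "complex_of_real (b j) * (poly (P j) z * poly (Q (Suc j)) z - poly (P (Suc j)) z * poly (Q j) z)
     = complex_of_real (\<epsilon> j)"
proof (induction j)
  case 0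
  then show ?case using poly_initial[of z] by simp
next
  case (Suc j)
  let ?B = "complex_of_real (b (Suc j))" and ?e = "\<lambda>j. complex_of_real (\<epsilon> j)"
  have "?B * (poly (P (Suc j)) z * poly (Q (Suc (Suc j))) z - poly (P (Suc (Suc j))) z * poly (Q (Suc j)) z)
      = poly (P (Suc j)) z * (?B * poly (Q (Suc (Suc j))) z)
        - (?B * poly (P (Suc (Suc j))) z) * poly (Q (Suc j)) z"
    by (simp add: algebra_simps)
  also have "\<dots> = ?e j * ?e (Suc j) * (complex_of_real (b j) *
      (poly (P j) z * poly (Q (Suc j)) z - poly (P (Suc j)) z * poly (Q j) z))"
    unfolding poly_recurrence by (simp add: algebra_simps)
  also have "\<dots> = (?e j * ?e j) * ?e (Suc j)"
    unfolding Suc.IH by (simp only: mult_ac)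
  finally show ?case by (simp add: sign_square)
qed

section \<open>Convergence along a subsequence\<close>

lemma filterlim_last_index: "filterlim last_index at_top sequentially"
proof (rule filterlim_subseq)
  show "strict_mono last_index"
    unfolding strict_mono_Suc_iff
  proof
    fix j show "last_index j < last_index (Suc j)"
      using offset_less_Suc[of j] offset_less_Suc[of "Suc j"] by linarith
  qed
qed

lemma infinite_large_P:
  assumes lim: "(\<lambda>j. poly (Q j) z + m * poly (P j) z) \<longlonglongrightarrow> 0"
  shows "infinite {j. 1 \<le> cmod (poly (P j) z)}"
proof
  assume "finite {j. 1 \<le> cmod (poly (P j) z)}"
  then obtain J where J: "\<And>j. 1 \<le> cmod (poly (P j) z) \<Longrightarrow> j < J"
    using finite_nat_set_iff_bounded by auto
  obtain M where M: "b j \<le> M" for j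
    using coeff_bound unfolding bdd_above_def by blast
  have Mpos: "M > 0" using b_pos[of 0] M[of 0] by linarith
  define w where "w j = poly (Q j) z + m * poly (P j) z" for j
  \<comment> \<open>The bound \<open>1 / (2 * M)\<close> is chosen so that two such terms times
    \<open>M\<close> give \<open>1\<close>, against the exact value \<open>1\<close> of the
    Wronskian expression.\<close>
  from lim Mpos have "\<forall>\<^sub>F j in sequentially. dist (w j) 0 < 1 / (2 * M)"
    unfolding w_def by (intro tendstoD) auto
  then obtain K where K: "\<And>j. j \<ge> K \<Longrightarrow> cmod (w j) < 1 / (2 * M)"
    unfolding eventually_sequentially by auto
  define j where "j = max J K"
  have P: "cmod (poly (P j) z) < 1" "cmod (poly (P (Suc j)) z) < 1"
    using J[of j] J[of "Suc j"] unfolding j_def by (meson not_le leI max.cobounded1 le_SucI not_less)+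
  have w: "cmod (w j) < 1 / (2 * M)" "cmod (w (Suc j)) < 1 / (2 * M)"
    using K[of j] K[of "Suc j"] by (auto simp: j_def)
  \<comment> \<open>Replacing \<open>Q\<close> by \<open>w = Q + m P\<close> does not change the
    Wronskian with \<open>P\<close>.\<close>
  have "complex_of_real (\<epsilon> j) =
      complex_of_real (b j) * (poly (P j) z * w (Suc j) - poly (P (Suc j)) z * w j)"
    unfolding w_def wronskian[of j z, symmetric] by (simp add: algebra_simps)
  then have "cmod (complex_of_real (\<epsilon> j)) =
      cmod (complex_of_real (b j) * (poly (P j) z * w (Suc j) - poly (P (Suc j)) z * w j))"
    by (rule arg_cong)
  then have "1 = b j * cmod (poly (P j) z * w (Suc j) - poly (P (Suc j)) z * w j)"
    using abs_sign[of j] b_pos[of j] by (simp add: norm_mult)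
  also have "\<dots> \<le> M * (cmod (w (Suc j)) + cmod (w j))"
  proof (intro mult_mono M)
    have "cmod (poly (P j) z * w (Suc j) - poly (P (Suc j)) z * w j)
        \<le> cmod (poly (P j) z) * cmod (w (Suc j)) + cmod (poly (P (Suc j)) z) * cmod (w j)"
      by (metis norm_mult norm_triangle_ineq4)
    also have "\<dots> \<le> 1 * cmod (w (Suc j)) + 1 * cmod (w j)"
      using P by (intro add_mono mult_right_mono) auto
    finally show "cmod (poly (P j) z * w (Suc j) - poly (P (Suc j)) z * w j)
        \<le> cmod (w (Suc j)) + cmod (w j)" by simp
  qed (use Mpos in auto)
  also have "\<dots> < M * (1 / (2 * M) + 1 / (2 * M))"
    using w Mpos by (intro mult_strict_left_mono add_strict_mono)
  finally show False using Mpos by simp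
qed

lemma exists_convergent_subsequence:
  assumes x: "x \<in> ell2" "shifted_op (jacobi_op \<epsilon> p b) z x = e_vec"
  defines "m \<equiv> complex_of_real (\<epsilon> 0) * x (last_index 0)"
  shows "\<exists>\<sigma> :: nat \<Rightarrow> nat. strict_mono \<sigma> \<and> (\<forall>i. 1 \<le> \<sigma> i \<and> poly (P (\<sigma> i)) z \<noteq> 0) \<and>
    (\<lambda>i. - poly (Q (\<sigma> i)) z / poly (P (\<sigma> i)) z) \<longlonglongrightarrow> m"
proof -
  define w where "w j = poly (Q j) z + m * poly (P j) z" for j
  have "cmod (w j) = cmod (x (last_index j))" for j
    using last_entry_eq[OF x(2), of j] abs_sign[of j] by (simp add: w_def m_def norm_mult)
  moreover have "(\<lambda>j. x (last_index j)) \<longlonglongrightarrow> 0"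
    by (rule filterlim_compose[OF ell2_tendsto_0[OF x(1)] filterlim_last_index])
  ultimately have w: "w \<longlonglongrightarrow> 0"
    using tendsto_norm_zero[of "\<lambda>j. x (last_index j)"] by - (rule tendsto_norm_zero_cancel, simp)
  \<comment> \<open>Index \<open>0\<close> is removed since the approximants are indexed from
    \<open>1\<close>.\<close>
  define S where "S = {j. 1 \<le> cmod (poly (P j) z)} - {0}"
  have "infinite S"
    using infinite_large_P[of z m] w unfolding w_def S_def by simp
  then obtain \<sigma> :: "nat \<Rightarrow> nat" where \<sigma>: "strict_mono \<sigma>" "\<And>i. \<sigma> i \<in> S"
    using infinite_enumerate[of S] by blast
  have P: "1 \<le> cmod (poly (P (\<sigma> i)) z)" "1 \<le> \<sigma> i" for i using \<sigma>(2)[of i] by (auto simp: S_def)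
  have nz: "poly (P (\<sigma> i)) z \<noteq> 0" for i using P(1)[of i] by auto
  have "(\<lambda>i. w (\<sigma> i)) \<longlonglongrightarrow> 0"
    using LIMSEQ_subseq_LIMSEQ[OF w \<sigma>(1)] by (simp add: o_def)
  then have "(\<lambda>i. w (\<sigma> i) / poly (P (\<sigma> i)) z) \<longlonglongrightarrow> 0"
  proof (rule tendsto_0_le[where K = 1], intro always_eventually allI)
    fix i
    show "cmod (w (\<sigma> i) / poly (P (\<sigma> i)) z) \<le> cmod (w (\<sigma> i)) * 1"
      using divide_left_mono[OF P(1)[of i], of "cmod (w (\<sigma> i))"] P(1)[of i] nz[of i]
      by (simp add: norm_divide)
  qed
  then have "(\<lambda>i. m - w (\<sigma> i) / poly (P (\<sigma> i)) z) \<longlonglongrightarrow> m - 0"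
    by (rule tendsto_diff[OF tendsto_const])
  moreover have "m - w (\<sigma> i) / poly (P (\<sigma> i)) z = - poly (Q (\<sigma> i)) z / poly (P (\<sigma> i)) z" for i
    using nz[of i] by (simp add: w_def add_divide_distrib)
  ultimately show ?thesis using \<sigma>(1) P(2) nz by auto
qed

end

section \<open>Pade approximation at infinity\<close>

text \<open>After the \<open>i\<close> vanishing terms the factor
  \<open>C ^ i / cmod z ^ (i + 1)\<close> splits off, and the remaining series is dominated by a
  geometric one of ratio \<open>1 / 2\<close>, hence the \<open>2\<close>.\<close>

lemma suminf_shifted_geometric_bound:
  fixes f :: "nat \<Rightarrow> complex"
  assumes f: "\<And>k. cmod (f k) \<le> C ^ k" and zero: "\<And>k. k < i \<Longrightarrow> f k = 0"
    and C: "0 < C" and z: "2 * C \<le> cmod z"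
  shows "summable (\<lambda>k. f k / z ^ (k + 1))"
    and "cmod (\<Sum>k. f k / z ^ (k + 1)) \<le> 2 * C ^ i / cmod z ^ (i + 1)"
proof -
  define a where "a = C ^ i / cmod z ^ (i + 1)"
  have zpos: "0 < cmod z" using C z by linarith
  have q: "C / cmod z \<le> 1 / 2" using C z zpos by (simp add: field_simps)
  have bound: "cmod (f (k + i) / z ^ (k + i + 1)) \<le> a * (1 / 2) ^ k" for k
  proof -
    have "cmod (f (k + i) / z ^ (k + i + 1)) \<le> C ^ (k + i) / cmod z ^ (k + i + 1)"
      unfolding norm_divide norm_power by (rule divide_right_mono[OF f]) simp
    also have "\<dots> = a * (C / cmod z) ^ k"
      by (simp add: a_def power_add power_divide mult_ac)
    also have "\<dots> \<le> a * (1 / 2) ^ k"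
      using q C zpos by (intro mult_left_mono power_mono) (auto simp: a_def)
    finally show ?thesis .
  qed
  have geo: "(\<lambda>k. a * (1 / 2) ^ k) sums (a * 2)"
    using sums_mult[OF geometric_sums[of "1 / 2 :: real"], of a] by simp
  have shifted: "summable (\<lambda>k. f (k + i) / z ^ (k + i + 1))"
    by (rule summable_comparison_test'[OF sums_summable[OF geo], of 0]) (use bound in simp)
  have sums: "(\<lambda>k. f k / z ^ (k + 1)) sums (\<Sum>k. f (k + i) / z ^ (k + i + 1))"
    using sums_zero_iff_shift[of i "\<lambda>k. f k / z ^ (k + 1)"] zero summable_sums[OF shifted]
    by simp
  then show "summable (\<lambda>k. f k / z ^ (k + 1))" by (rule sums_summable)
  have "cmod (\<Sum>k. f (k + i) / z ^ (k + i + 1)) \<le> (\<Sum>k. a * (1 / 2) ^ k)"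
    by (rule norm_suminf_le[OF bound sums_summable[OF geo]])
  then show "cmod (\<Sum>k. f k / z ^ (k + 1)) \<le> 2 * C ^ i / cmod z ^ (i + 1)"
    using sums_unique[OF sums] sums_unique[OF geo] by (simp add: a_def mult_ac)
qed

text \<open>Passes from the linearised error \<open>R - \<phi> D\<close> to the error of the
  quotient. Division by \<open>D\<close>, which has exact degree \<open>n\<close>, gains a factor of
  order \<open>1 / z ^ n\<close> and raises the order \<open>n + 1\<close> to
  \<open>2 * n + 1\<close>.\<close>

lemma is_diagonal_padeI:
  fixes R D :: "complex poly"
  assumes D: "D \<noteq> 0" "degree D = n" and R: "degree R \<le> n"
    and \<phi>: "\<forall>\<^sub>F z in at_infinity. (\<lambda>j. - (s j / z ^ (j + 1))) sums \<phi> z"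
    and order: "(\<lambda>z. poly R z - \<phi> z * poly D z) \<in> O[at_infinity](\<lambda>z. 1 / z ^ (n + 1))"
  shows "is_diagonal_pade \<phi> n R D"
proof -
  \<comment> \<open>The monomial pads the reversal of \<open>R\<close> so that numerator and
    denominator are divided by the same power \<open>z ^ n\<close>.\<close>
  define A where "A = monom 1 (n - degree R) * reflect_poly R"
  define B where "B = reflect_poly D"
  have A: "poly A (1 / z) = poly R z / z ^ n" if "z \<noteq> 0" for z
    using that R
    by (simp add: A_def poly_monom poly_reflect_poly_nz inverse_eq_divide power_one_over
        power_diff field_simps)
  have B: "poly B (1 / z) = poly D z / z ^ n" if "z \<noteq> 0" for z
    using that D(2) by (simp add: B_def poly_reflect_poly_nz inverse_eq_divide power_one_over)
  have B0: "poly B 0 \<noteq> 0" using D(1) by (simp add: B_def)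
  have degA: "degree A \<le> n"
  proof -
    have "degree A \<le> (n - degree R) + degree (reflect_poly R)"
      unfolding A_def by (rule order_trans[OF degree_mult_le]) (simp add: degree_monom_eq)
    then show ?thesis using degree_reflect_poly_le[of R] R by linarith
  qed
  have degB: "degree B \<le> n" using degree_reflect_poly_le[of D] D(2) by (simp add: B_def)
  have nz: "\<forall>\<^sub>F z :: complex in at_infinity. z \<noteq> 0"
    by (rule eventually_mono[OF eventually_not_equal_at_infinity]) simp
  have "((\<lambda>z. poly B (1 / z)) \<longlongrightarrow> poly B 0) at_infinity"
    by (rule tendsto_poly) (rule tendsto_divide_0[OF tendsto_const filterlim_ident])
  then have Binv: "((\<lambda>z. 1 / poly B (1 / z)) \<longlongrightarrow> 1 / poly B 0) at_infinity"
    and Bnz: "\<forall>\<^sub>F z in at_infinity. poly B (1 / z) \<noteq> 0"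
    using B0 by (intro tendsto_divide tendsto_const tendsto_imp_eventually_ne; simp)+
  \<comment> \<open>\<open>B\<close> at \<open>0\<close> is the leading coefficient of
    \<open>D\<close>, so the reciprocal stays bounded near infinity.\<close>
  have Binv': "(\<lambda>z. 1 / poly B (1 / z)) \<in> O[at_infinity](\<lambda>_. 1)"
    by (rule bigoI_tendsto[where c = "1 / poly B 0"]) (use Binv in auto)
  have "(\<lambda>z. (poly R z - \<phi> z * poly D z) * (1 / z ^ n) * (1 / poly B (1 / z)))
      \<in> O[at_infinity](\<lambda>z. 1 / z ^ (n + 1) * (1 / z ^ n) * 1)"
    by (intro landau_o.big.mult order Binv') simp
  also have "(\<lambda>z. 1 / z ^ (n + 1) * (1 / z ^ n) * 1) = (\<lambda>z :: complex. 1 / z ^ (2 * n + 1))"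
    by (simp add: fun_eq_iff mult_2 power_add)
  also have "(\<lambda>z. (poly R z - \<phi> z * poly D z) * (1 / z ^ n) * (1 / poly B (1 / z)))
        \<in> O[at_infinity](\<lambda>z. 1 / z ^ (2 * n + 1)) \<longleftrightarrow>
      (\<lambda>z. (\<Sum>j. s j / z ^ (j + 1)) + poly A (1 / z) / poly B (1 / z))
        \<in> O[at_infinity](\<lambda>z. 1 / z ^ (2 * n + 1))"
  proof (rule landau_o.big.in_cong)
    show "\<forall>\<^sub>F z in at_infinity. (poly R z - \<phi> z * poly D z) * (1 / z ^ n) * (1 / poly B (1 / z)) =
        (\<Sum>j. s j / z ^ (j + 1)) + poly A (1 / z) / poly B (1 / z)"
      using \<phi> nz Bnz
    proof eventually_elim
      case (elim z)
      have "(\<Sum>j. s j / z ^ (j + 1)) = - \<phi> z"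
        using sums_minus[OF elim(1)] by (simp add: sums_iff)
      moreover have "poly D z \<noteq> 0" using elim(2,3) B by auto
      ultimately show ?case
        using elim(2) by (simp add: A B field_simps)
    qed
  qed
  finally have "(\<lambda>z. (\<Sum>j. s j / z ^ (j + 1)) + poly A (1 / z) / poly B (1 / z))
      \<in> O[at_infinity](\<lambda>z. 1 / z ^ (2 * n + 1))" .
  moreover have "poly R z / poly D z = poly A (1 / z) / poly B (1 / z)" if "z \<noteq> 0" for z
    using that by (simp add: A B)
  ultimately show ?thesis
    unfolding is_diagonal_pade_def using D(1) \<phi> degA degB B0 by blast
qed

context jacobi_data
begin

section \<open>The Neumann series of the resolvent for large \<open>z\<close>\<close>

abbreviation H :: "(nat \<Rightarrow> complex) \<Rightarrow> nat \<Rightarrow> complex" where "H \<equiv> jacobi_op \<epsilon> p b"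

lemma jacobi_op_diff: "H (\<lambda>l. x l - y l) i = H x i - H y i"
proof -
  obtain j r where i: "i = offset p j + r" and r: "r < degree (p j)" by (rule index_cases)
  show ?thesis unfolding i jacobi_op_eq[OF r] by (simp add: algebra_simps)
qed

lemma jacobi_op_scale: "H (\<lambda>l. c * x l) i = c * H x i"
proof -
  obtain j r where i: "i = offset p j + r" and r: "r < degree (p j)" by (rule index_cases)
  show ?thesis unfolding i jacobi_op_eq[OF r] by (simp add: algebra_simps)
qed

text \<open>Rows are finite, so entrywise convergence is enough to interchange \<open>H\<close> with
  the series.\<close>

lemma jacobi_op_sums:
  assumes "\<And>l. (\<lambda>k. f k l) sums g l"
  shows "(\<lambda>k. H (f k) i) sums H g i"
proof -
  obtain j r where i: "i = offset p j + r" and r: "r < degree (p j)" by (rule index_cases)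
  show ?thesis
    unfolding i jacobi_op_eq[OF r]
    by (cases "r = 0"; cases "j = 0")
      (simp_all, (intro sums_add sums_diff sums_mult sums_zero assms | simp)+)
qed

lemma jacobi_op_bounded:
  "\<exists>C>0. \<forall>x K i. (\<forall>l. cmod (x l) \<le> K) \<longrightarrow> cmod (H x i) \<le> C * K"
proof -
  obtain M where M: "\<And>a. a \<in> {b j | j. True} \<union> {\<bar>coeff (p j) k\<bar> | j k. k < degree (p j)} \<Longrightarrow> a \<le> M"
    using coeff_bound unfolding bdd_above_def by blast
  have bM: "b j \<le> M" for j by (rule M) blast
  have cM: "\<bar>coeff (p j) r\<bar> \<le> M" if "r < degree (p j)" for j r
    by (rule M) (use that in blast)
  have Mpos: "0 < M" using b_pos[of 0] bM[of 0] by linarith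
  \<comment> \<open>The subdiagonal entry is \<open>1\<close> or some \<open>b\<close>, hence at
    most \<open>1 + M\<close>; the companion coefficient and the corner entry add \<open>M\<close>
    each.\<close>
  have "cmod (H x i) \<le> (1 + 3 * M) * K" if x: "\<And>l. cmod (x l) \<le> K" for x K i
  proof -
    obtain j r where i: "i = offset p j + r" and r: "r < degree (p j)" by (rule index_cases)
    have K: "0 \<le> K" using x[of 0] norm_ge_zero[of "x 0"] by linarith
    have entry: "cmod (complex_of_real a * x l) \<le> M * K" if "\<bar>a\<bar> \<le> M" for a l
      unfolding norm_mult using that x[of l] Mpos by (intro mult_mono) auto
    let ?s = "if r = 0 then if j = 0 then 0 else complex_of_real (b (j - 1)) * x (last_index (j - 1))
      else x (offset p j + (r - 1))"
    let ?t = "if r = 0 then complex_of_real (\<epsilon> j * \<epsilon> (Suc j) * b j) * x (last_index (Suc j)) else 0"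
    have "0 \<le> M * K" using Mpos K by simp
    moreover have "cmod ?s \<le> K + M * K"
    proof -
      have "cmod (complex_of_real (b (j - 1)) * x (last_index (j - 1))) \<le> K + M * K"
        using entry[of "b (j - 1)" "last_index (j - 1)"] b_pos[of "j - 1"] bM[of "j - 1"] K
        by linarith
      moreover have "cmod (x (offset p j + (r - 1))) \<le> K + M * K"
        using x[of "offset p j + (r - 1)"] \<open>0 \<le> M * K\<close> by linarith
      moreover have "cmod 0 \<le> K + M * K"
        using K \<open>0 \<le> M * K\<close> by simp
      ultimately show ?thesis by (cases "r = 0"; cases "j = 0") simp_all
    qed
    moreover have "cmod (complex_of_real (coeff (p j) r) * x (last_index j)) \<le> M * K"
      by (rule entry[OF cM[OF r]])
    moreover have "cmod ?t \<le> M * K"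
    proof -
      have "\<bar>\<epsilon> j * \<epsilon> (Suc j) * b j\<bar> \<le> M"
        using b_pos[of j] bM[of j] by (simp add: abs_mult abs_sign)
      from entry[OF this] show ?thesis using \<open>0 \<le> M * K\<close> by auto
    qed
    moreover have "cmod (H x i) \<le>
        cmod ?s + cmod (complex_of_real (coeff (p j) r) * x (last_index j)) + cmod ?t"
      unfolding i jacobi_op_eq[OF r]
      by (rule order_trans[OF norm_triangle_ineq add_right_mono[OF norm_triangle_ineq4]])
    ultimately show ?thesis by (simp add: algebra_simps)
  qed
  then show ?thesis using Mpos by (intro exI[of _ "1 + 3 * M"]) auto
qed

text \<open>Apart from the single subdiagonal, row \<open>i\<close> of \<open>H\<close> has entries
  only in columns at least \<open>i\<close>, so an application of \<open>H\<close> extends the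
  support by at most one index.\<close>

lemma jacobi_op_lower_band:
  assumes "\<And>l. n < l \<Longrightarrow> x l = 0" and "Suc n < i"
  shows "H x i = 0"
proof -
  obtain j r where i: "i = offset p j + r" and r: "r < degree (p j)" by (rule index_cases)
  have 1: "n < last_index j" using assms(2) r unfolding i last_index_eq by linarith
  have 2: "n < last_index (Suc j)"
    using 1 offset_less_Suc[of "Suc j"] by linarith
  have 3: "n < last_index (j - 1)" if "r = 0" "j \<noteq> 0"
  proof -
    have "last_index (j - 1) = offset p j - 1" using that(2) by simp
    then show ?thesis using assms(2) that(1) unfolding i by linarith
  qed
  have 4: "n < offset p j + (r - 1)" if "r \<noteq> 0"
    using assms(2) that unfolding i by linarith
  show ?thesis
    unfolding i jacobi_op_eq[OF r] using assms(1) 1 2 3 4 by auto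
qed

abbreviation h :: "nat \<Rightarrow> nat \<Rightarrow> complex" where "h k \<equiv> (H ^^ k) e_vec"

lemma power_e_vec_zero: "k < i \<Longrightarrow> h k i = 0"
proof (induction k arbitrary: i)
  case (Suc k)
  show ?case
    using jacobi_op_lower_band[of k "h k" i] Suc by simp
qed (simp add: e_vec_def)

text \<open>The Neumann series \<open>y\<close> solves the equation entrywise and decays
  geometrically in \<open>i\<close>, so it is square summable. Uniqueness uses the sup norm: for a
  difference \<open>d\<close> of two solutions \<open>H d = z d\<close>, and \<open>cmod z\<close>
  at least \<open>2 * C\<close> lets every bound on \<open>d\<close> be halved.\<close>

lemma large_z_resolvent:
  assumes C: "0 < C" "\<forall>x K i. (\<forall>l. cmod (x l) \<le> K) \<longrightarrow> cmod (H x i) \<le> C * K"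
    and z: "2 * C \<le> cmod z"
  defines "x \<equiv> resolvent H z e_vec"
  shows "shifted_op H z x = e_vec" and "(\<lambda>k. - (h k i / z ^ (k + 1))) sums x i"
    and "cmod (x i) \<le> 2 * C ^ i / cmod z ^ (i + 1)"
proof -
  have z0: "z \<noteq> 0" "0 < cmod z" using C(1) z by auto
  have hC: "cmod (h k i) \<le> C ^ k" for k i
  proof (induction k arbitrary: i)
    case (Suc k)
    then have "cmod (H (h k) i) \<le> C * C ^ k" using C(2) by blast
    then show ?case by simp
  qed (simp add: e_vec_def)
  define y where "y i = - (\<Sum>k. h k i / z ^ (k + 1))" for i
  have ysum: "(\<lambda>k. - (h k i / z ^ (k + 1))) sums y i"
    and ybound: "cmod (y i) \<le> 2 * C ^ i / cmod z ^ (i + 1)" for i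
    using suminf_shifted_geometric_bound[of "\<lambda>k. h k i" C i z, OF hC power_e_vec_zero C(1) z]
    by (auto simp: y_def intro!: sums_minus summable_sums)
  have yeq: "shifted_op H z y = e_vec"
  proof
    fix i
    \<comment> \<open>Applying \<open>H\<close> term by term shifts the series for
      \<open>z * y i\<close> by one index; the missing term \<open>k = 0\<close> is
      \<open>- e_vec i\<close>.\<close>
    have "H (\<lambda>l. - (h k l / z ^ (k + 1))) i = - (h (Suc k) i / z ^ (k + 1))" for k
      using jacobi_op_scale[of "- 1 / z ^ (k + 1)" "h k" i] by simp
    then have "(\<lambda>k. - (h (Suc k) i / z ^ (k + 1))) sums H y i"
      using jacobi_op_sums[of "\<lambda>k l. - (h k l / z ^ (k + 1))" y i, OF ysum] by simp
    then have "(\<lambda>k. - (h k i / z ^ k)) sums (H y i + - (h 0 i / z ^ 0))"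
      using sums_Suc_iff[of "\<lambda>k. - (h k i / z ^ k)"] by simp
    moreover have "(\<lambda>k. - (h k i / z ^ k)) sums (z * y i)"
      using sums_mult[OF ysum[of i], of z] z0 by simp
    ultimately have "z * y i = H y i - e_vec i"
      using sums_unique2 by fastforce
    then show "shifted_op H z y i = e_vec i"
      unfolding shifted_op_def by simp
  qed
  have yell2: "y \<in> ell2"
    unfolding ell2_def mem_Collect_eq
  proof (rule summable_comparison_test')
    show "summable (\<lambda>i. (2 / cmod z)\<^sup>2 * (1 / 4) ^ i)"
      by (intro summable_mult summable_geometric) simp
    fix i :: nat
    have "2 * C ^ i / cmod z ^ (i + 1) = 2 / cmod z * (C / cmod z) ^ i"
      by (simp add: power_divide)
    also have "\<dots> \<le> 2 / cmod z * (1 / 2) ^ i"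
      using C(1) z z0 by (intro mult_left_mono power_mono) (auto simp: field_simps)
    finally have "cmod (y i) \<le> 2 / cmod z * (1 / 2) ^ i"
      using ybound[of i] by linarith
    then have "(cmod (y i))\<^sup>2 \<le> (2 / cmod z * (1 / 2) ^ i)\<^sup>2"
      by (rule power_mono) simp
    also have "\<dots> = (2 / cmod z)\<^sup>2 * ((1 / 2)\<^sup>2) ^ i"
      unfolding power_mult_distrib by (simp only: power_mult[symmetric] mult.commute)
    finally show "norm ((cmod (y i))\<^sup>2) \<le> (2 / cmod z)\<^sup>2 * (1 / 4) ^ i"
      by (simp add: power2_eq_square)
  qed
  have unique: "x' = y" if x': "x' \<in> ell2" "shifted_op H z x' = e_vec" for x'
  proof -
    define d where "d i = x' i - y i" for i
    have Hd: "H d i = z * d i" for i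
      using fun_cong[OF x'(2), of i] fun_cong[OF yeq, of i] jacobi_op_diff[of x' y i]
      unfolding shifted_op_def d_def by (simp add: algebra_simps)
    \<comment> \<open>Square summable sequences tend to \<open>0\<close> and are therefore bounded,
      which starts the halving.\<close>
    have "d \<longlonglongrightarrow> 0 - 0"
      unfolding d_def by (intro tendsto_diff ell2_tendsto_0 x'(1) yell2)
    then have "Bseq d" by (intro convergent_imp_Bseq convergentI)
    then obtain K where K: "\<And>i. cmod (d i) \<le> K" unfolding Bseq_def by blast
    have "cmod (d i) \<le> K * (1 / 2) ^ n" for i n
    proof (induction n arbitrary: i)
      case (Suc n)
      have "2 * C * cmod (d i) \<le> cmod z * cmod (d i)"
        using z by (intro mult_right_mono) auto
      also have "\<dots> = cmod (H d i)" by (simp add: Hd norm_mult)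
      also have "\<dots> \<le> C * (K * (1 / 2) ^ n)" using C(2) Suc.IH by blast
      finally have "C * (2 * cmod (d i)) \<le> C * (K * (1 / 2) ^ n)" by (simp add: mult_ac)
      then have "2 * cmod (d i) \<le> K * (1 / 2) ^ n"
        using C(1) by (simp only: mult_le_cancel_left_pos)
      then show ?case by simp
    qed (use K in simp)
    moreover have "(\<lambda>n. K * (1 / 2) ^ n) \<longlonglongrightarrow> K * 0"
      by (intro tendsto_mult tendsto_const LIMSEQ_power_zero) simp
    ultimately have "cmod (d i) \<le> K * 0" for i
      by (intro LIMSEQ_le_const) auto
    then show "x' = y" by (auto simp: d_def fun_eq_iff)
  qed
  have "x = y"
    unfolding x_def by (rule resolvent_eqI[OF yell2 yeq unique])
  then show "shifted_op H z x = e_vec" "(\<lambda>k. - (h k i / z ^ (k + 1))) sums x i"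
    "cmod (x i) \<le> 2 * C ^ i / cmod z ^ (i + 1)"
    using yeq ysum ybound by auto
qed

section \<open>Degrees of \<open>P\<close> and \<open>Q\<close> and the order of contact\<close>

lemma P_degree: "P j \<noteq> 0 \<and> degree (P j) = offset p j"
proof -
  let ?u = "recurrence_solution \<epsilon> p b 1 (Polynomial.smult (1 / b 0) (p 0))"
  have p0: "p j \<noteq> 0" for j using monic[of j] by auto
  have "(?u j \<noteq> 0 \<and> degree (?u j) = offset p j)
      \<and> (?u (Suc j) \<noteq> 0 \<and> degree (?u (Suc j)) = offset p (Suc j))"
  proof (induction j)
    case 0
    then show ?case using p0[of 0] b_pos[of 0] by (simp add: offset_0 offset_Suc)
  next
    case (Suc j)
    let ?v = "Polynomial.smult (\<epsilon> j * \<epsilon> (Suc j) * b j) (?u j)"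
    let ?t = "p (Suc j) * ?u (Suc j)"
    have t: "degree ?t = offset p (Suc (Suc j))"
      using Suc p0[of "Suc j"] by (simp add: degree_mult_eq offset_Suc)
    have "degree ?v \<le> offset p j" using Suc degree_smult_le[of _ "?u j"] by metis
    \<comment> \<open>The second term lags by two blocks, so the leading term of the product cannot
      cancel.\<close>
    then have "degree ?v < degree ?t"
      using offset_less_Suc[of j] offset_less_Suc[of "Suc j"] unfolding t by linarith
    then have d: "degree (?t - ?v) = offset p (Suc (Suc j))"
      unfolding diff_conv_add_uminus using t by (subst degree_add_eq_left) simp_all
    then have "?t - ?v \<noteq> 0" using offset_less_Suc[of "Suc j"] by force
    with Suc d show ?case using b_pos[of "Suc j"] by simp
  qed
  then show ?thesis
    unfolding P_poly_def by (auto simp: degree_map_poly_of_real map_poly_eq_0_iff)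
qed

lemma Q_degree: "degree (Q j) \<le> offset p j"
proof -
  let ?u = "recurrence_solution \<epsilon> p b 0 [:\<epsilon> 0 / b 0:]"
  have "degree (?u j) \<le> offset p j \<and> degree (?u (Suc j)) \<le> offset p (Suc j)"
  proof (induction j)
    case (Suc j)
    have "degree (p (Suc j) * ?u (Suc j)) \<le> offset p (Suc (Suc j))"
      using degree_mult_le[of "p (Suc j)" "?u (Suc j)"] Suc by (simp add: offset_Suc)
    moreover have "degree (Polynomial.smult (\<epsilon> j * \<epsilon> (Suc j) * b j) (?u j)) \<le> offset p (Suc (Suc j))"
      using degree_smult_le[of "\<epsilon> j * \<epsilon> (Suc j) * b j" "?u j"] Suc
        offset_mono[of j "Suc (Suc j)"] by linarith
    ultimately show ?case
      using Suc by (simp add: degree_diff_le order_trans[OF degree_smult_le])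
  qed simp
  then show ?thesis by (simp add: Q_poly_def degree_map_poly_of_real)
qed

text \<open>The order of contact comes from
  \<open>x = (H - z)\<^sup>-\<^sup>1 e\<close> having \<open>i\<close>-th entry \<open>O(z^(- i - 1))\<close>, since \<open>H^k e\<close> is supported
  on \<open>{0..k}\<close>.\<close>

lemma diagonal_pade:
  "is_diagonal_pade (m_function \<epsilon> p b) (offset p j) (- Q j) (P j)"
proof -
  obtain C where C: "0 < C" "\<forall>x K i. (\<forall>l. cmod (x l) \<le> K) \<longrightarrow> cmod (H x i) \<le> C * K"
    using jacobi_op_bounded by blast
  define R where "R z = resolvent H z e_vec" for z
  note R = large_z_resolvent[OF C, folded R_def]
  have large: "\<forall>\<^sub>F z :: complex in at_infinity. 2 * C \<le> cmod z"
    by (auto simp: eventually_at_infinity)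
  have m: "m_function \<epsilon> p b z = complex_of_real (\<epsilon> 0) * R z (last_index 0)" for z
    by (simp add: m_function_def indef_inner_e_vec R_def)
  \<comment> \<open>By \<open>indef_inner_e_vec\<close> these are the moments
    \<open>[H^k e, e]\<close>.\<close>
  define s where "s k = complex_of_real (\<epsilon> 0) * h k (last_index 0)" for k
  show ?thesis
  proof (rule is_diagonal_padeI[where s = s])
    show "P j \<noteq> 0" "degree (P j) = offset p j" using P_degree by auto
    show "degree (- Q j) \<le> offset p j" using Q_degree by simp
    show "\<forall>\<^sub>F z in at_infinity. (\<lambda>k. - (s k / z ^ (k + 1))) sums m_function \<epsilon> p b z"
      using large
    proof eventually_elim
      case (elim z)
      from sums_mult[OF R(2)[OF elim, of "last_index 0"], of "complex_of_real (\<epsilon> 0)"]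
      show ?case by (simp add: m s_def)
    qed
    show "(\<lambda>z. poly (- Q j) z - m_function \<epsilon> p b z * poly (P j) z)
        \<in> O[at_infinity](\<lambda>z. 1 / z ^ (offset p j + 1))"
    proof (rule bigoI)
      show "\<forall>\<^sub>F z in at_infinity. cmod (poly (- Q j) z - m_function \<epsilon> p b z * poly (P j) z)
          \<le> 2 * C ^ offset p j * cmod (1 / z ^ (offset p j + 1))"
        using large
      proof eventually_elim
        case (elim z)
        have "0 < cmod z" "C \<le> cmod z"
          using elim C(1) by linarith+
        then have q: "0 \<le> C / cmod z" "C / cmod z \<le> 1"
          using C(1) by simp_all
        define c where "c = degree (p j) - 1"
        have c: "last_index j = offset p j + c" unfolding c_def by (rule last_index_eq)
        \<comment> \<open>Up to a sign, the linearised error is the last entry of block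
          \<open>j\<close> of the resolvent vector.\<close>
        have "poly (- Q j) z - m_function \<epsilon> p b z * poly (P j) z
            = - (poly (Q j) z + complex_of_real (\<epsilon> 0) * R z (last_index 0) * poly (P j) z)"
          unfolding m by simp
        then have "cmod (poly (- Q j) z - m_function \<epsilon> p b z * poly (P j) z) = cmod (R z (last_index j))"
          unfolding last_entry_eq[OF R(1)[OF elim], of j] norm_mult norm_of_real abs_sign
          by (simp only: norm_minus_cancel mult_1_left)
        also have "\<dots> \<le> 2 * C ^ last_index j / cmod z ^ (last_index j + 1)"
          by (rule R(3)[OF elim])
        \<comment> \<open>The last entry lies \<open>c\<close> places beyond
          \<open>offset p j\<close>; the surplus factor \<open>(C / cmod z) ^ c\<close> is at most
          \<open>1\<close> and is dropped.\<close>
        also have "\<dots> = 2 * C ^ offset p j / cmod z ^ (offset p j + 1) * (C / cmod z) ^ c"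
          unfolding c by (simp add: power_add power_divide mult_ac)
        also have "\<dots> \<le> 2 * C ^ offset p j / cmod z ^ (offset p j + 1) * 1"
          using q C(1) by (intro mult_left_mono power_le_one) auto
        finally show ?case by (simp add: norm_divide norm_power norm_mult)
      qed
    qed
  qed
qed

end

theorem theorem7p6:
  fixes p :: "nat \<Rightarrow> real poly" and \<epsilon> b :: "nat \<Rightarrow> real" and N :: nat and z :: complex
  assumes monic: "\<And>j. lead_coeff (p j) = 1"
    and degree_pos: "\<And>j. 1 \<le> degree (p j)"
    and signs: "\<And>j. \<epsilon> j \<in> {1, -1}"
    and b_pos: "\<And>j. 0 < b j"
    and degree_bound: "\<And>j. degree (p j) \<le> N"
    and coeff_bound:
      "bdd_above ({b j | j. True} \<union> {\<bar>coeff (p j) k\<bar> | j k. k < degree (p j)})"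
    and z: "z \<in> resolvent_set (jacobi_op \<epsilon> p b)"
  shows "\<exists>\<sigma> :: nat \<Rightarrow> nat. strict_mono \<sigma> \<and>
    (\<forall>i. 1 \<le> \<sigma> i \<and>
         is_diagonal_pade (m_function \<epsilon> p b) (offset p (\<sigma> i))
           (- Q_poly \<epsilon> p b (\<sigma> i)) (P_poly \<epsilon> p b (\<sigma> i)) \<and>
         poly (P_poly \<epsilon> p b (\<sigma> i)) z \<noteq> 0) \<and>
    (\<lambda>i. - poly (Q_poly \<epsilon> p b (\<sigma> i)) z / poly (P_poly \<epsilon> p b (\<sigma> i)) z)
      \<longlonglongrightarrow> m_function \<epsilon> p b z"
proof -
  interpret jacobi_data p \<epsilon> b
    using monic degree_pos signs b_pos coeff_bound by unfold_locales
  show ?thesis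
    using exists_convergent_subsequence[OF resolvent_solves[OF z e_vec_in_ell2]] diagonal_pade
    unfolding m_function_def indef_inner_e_vec by blast
qed

end
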